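(* Let $r\ge 1$ be an integer. Let $X_1,\dots,X_r$ be independent random variables, each with the standard uniform distribution on $(0,1)$. Let $W=\langle W_1,\dots,W_r\rangle$ be a random vector with the $\mathrm{Dirichlet}(2,\dots,2)$ distribution ($r$ parameters, all equal to $2$), independent of $(X_1,\dots,X_r)$. Then the randomly weighted average $Z=\sum_{j=1}^{r}W_jX_j$ has the $\mathrm{Beta}(r,r)$ distribution.
   Context: For $p,q>0$, $\mathrm{Beta}(p,q)$ is the distribution on $(0,1)$ with density $\frac{\Gamma(p+q)}{\Gamma(p)\Gamma(q)}x^{p-1}(1-x)^{q-1}$. For $\alpha_1,\dots,\alpha_r>0$, $\mathrm{Dirichlet}(\alpha_1,\dots,\alpha_r)$ is the distribution of a random vector $\langle W_1,\dots,W_r\rangle$ with $W_j\ge 0$, $\sum_{j}W_j=1$, such that $(W_1,\dots,W_{r-1})$ has density $\frac{\Gamma(\alpha_1+\cdots+\alpha_r)}{\prod_{j}\Gamma(\alpha_j)}\prod_{j=1}^{r}w_j^{\alpha_j-1}$ on $\{w_1,\dots,w_{r-1}>0,\ \sum_{j<r}w_j<1\}$, where $w_r=1-\sum_{j<r}w_j$ (for $r=1$, $W_1=1$ almost surely). Randomly weighted average: for independent random variables $X_1,\dots,X_r$ and a Dirichlet distributed random vector $W=\langle W_1,\dots,W_r\rangle$ (with $\sum_j W_j=1$) that is independent of the $X_j$'s, the randomly weighted average of the $X_j$'s is $Z=\sum_{j=1}^{r}W_jX_j$. *)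

theory Defs
  imports "HOL-Probability.Probability"
begin

definition beta_density :: "real \<Rightarrow> real \<Rightarrow> real \<Rightarrow> real" where
  "beta_density p q x =
     (if 0 < x \<and> x < 1
      then Gamma (p + q) / (Gamma p * Gamma q) * x powr (p - 1) * (1 - x) powr (q - 1)
      else 0)"

text \<open>
  The coordinates of a Dirichlet vector are indexed by \<open>1, \<dots>, r\<close> with \<open>r \<ge> 1\<close>, and the
  density is a density for the first \<open>r - 1\<close> of them, with respect to Lebesgue measure on
  functions over \<open>{1..<r}\<close>.  For \<open>r = 1\<close> the index set is empty, and the density
  is the constant 1 on a one-point space.
\<close>

definition dirichlet_density :: "nat \<Rightarrow> (nat \<Rightarrow> real) \<Rightarrow> (nat \<Rightarrow> real) \<Rightarrow> real" where
  "dirichlet_density r \<alpha> w =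
     (if (\<forall>j\<in>{1..<r}. 0 < w j) \<and> (\<Sum>j\<in>{1..<r}. w j) < 1
      then Gamma (\<Sum>j\<in>{1..r}. \<alpha> j) / (\<Prod>j\<in>{1..r}. Gamma (\<alpha> j)) *
           ((\<Prod>j\<in>{1..<r}. w j powr (\<alpha> j - 1)) * (1 - (\<Sum>j\<in>{1..<r}. w j)) powr (\<alpha> r - 1))
      else 0)"

text \<open>
  The constraints on the weights are only required almost surely, since being Dirichlet
  distributed is a property of the law of the vector.
\<close>

definition dirichlet_distributed ::
  "'a measure \<Rightarrow> nat \<Rightarrow> (nat \<Rightarrow> real) \<Rightarrow> (nat \<Rightarrow> 'a \<Rightarrow> real) \<Rightarrow> bool" where
  "dirichlet_distributed M r \<alpha> W \<longleftrightarrow>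
     (\<forall>j\<in>{1..r}. W j \<in> borel_measurable M) \<and>
     (AE \<omega> in M. (\<forall>j\<in>{1..r}. 0 \<le> W j \<omega>) \<and> (\<Sum>j\<in>{1..r}. W j \<omega>) = 1) \<and>
     distributed M (Pi\<^sub>M {1..<r} (\<lambda>_. lborel)) (\<lambda>\<omega>. \<lambda>j\<in>{1..<r}. W j \<omega>)
       (\<lambda>w. ennreal (dirichlet_density r \<alpha> w))"

end

theory Submission imports Defs begin

text \<open>
  Independent Gamma variables \<open>w\<^sub>1, \<dots>, w\<^sub>r\<close> of shape 2 have a Gamma distributed sum \<open>s\<close> that is
  independent of the Dirichlet(2, \<dots>, 2) vector \<open>w / s\<close>, so \<open>Z\<close> may be realised as
  \<open>(\<Sum>j. w\<^sub>j X\<^sub>j) / s\<close>.  If \<open>w\<close> is Gamma of shape 2 and \<open>X\<close> is uniform, then \<open>w X\<close> and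
  \<open>w (1 - X)\<close> are independent standard exponentials.  Hence \<open>a = \<Sum>j. w\<^sub>j X\<^sub>j\<close> and
  \<open>b = \<Sum>j. w\<^sub>j (1 - X\<^sub>j)\<close> are independent Gamma variables of shape \<open>r\<close>, and
  \<open>Z = a / (a + b)\<close> is Beta distributed.
\<close>

section \<open>Gamma laws of integer shape\<close>

text \<open>
  The shape parameter is \<open>k + 1\<close>.  Unlike \<open>erlang_density k 1\<close>, the density vanishes at 0 also
  for \<open>k = 0\<close>, which makes it agree with the Dirichlet density on the boundary of the simplex.
\<close>

definition gamma_dens :: "nat \<Rightarrow> real \<Rightarrow> real" where
  "gamma_dens k x = (if 0 < x then x ^ k * exp (- x) / fact k else 0)"

definition gamma_law :: "nat \<Rightarrow> real measure" where
  "gamma_law k = density lborel (\<lambda>x. ennreal (gamma_dens k x))"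

lemma gamma_dens_nonneg [simp]: "0 \<le> gamma_dens k x"
  by (simp add: gamma_dens_def)

lemma borel_measurable_gamma_dens [measurable]: "gamma_dens k \<in> borel_measurable borel"
  unfolding gamma_dens_def by measurable

lemma sets_gamma_law [simp, measurable_cong]: "sets (gamma_law k) = sets borel"
  by (simp add: gamma_law_def)

lemma space_gamma_law [simp]: "space (gamma_law k) = UNIV"
  by (simp add: gamma_law_def)

text \<open>Away from the null set consisting of 0, the density is the Erlang density of rate 1,
  whose total mass is known.\<close>

lemma prob_space_gamma_law: "prob_space (gamma_law k)"
proof -
  have "gamma_law k = density lborel (\<lambda>x. ennreal (erlang_density k 1 x))"
    unfolding gamma_law_def
  proof (rule density_cong)
    show "AE x in lborel. ennreal (gamma_dens k x) = ennreal (erlang_density k 1 x)"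
      using AE_lborel_singleton[of 0]
      by eventually_elim (auto simp: gamma_dens_def erlang_density_def)
  qed auto
  then show ?thesis
    using prob_space_erlang_density[of 1 k] by simp
qed

lemma sigma_finite_gamma_law: "sigma_finite_measure (gamma_law k)"
proof -
  interpret prob_space "gamma_law k" by (rule prob_space_gamma_law)
  show ?thesis by unfold_locales
qed

lemma nn_integral_gamma_law:
  assumes [measurable]: "f \<in> borel_measurable borel"
  shows "(\<integral>\<^sup>+x. f x \<partial>gamma_law k) = (\<integral>\<^sup>+x. ennreal (gamma_dens k x) * f x \<partial>lborel)"
  unfolding gamma_law_def by (subst nn_integral_density) auto

lemma AE_gamma_law_pos: "AE x in gamma_law k. 0 < x"
  unfolding gamma_law_def by (subst AE_density) (auto simp: gamma_dens_def)

section \<open>Integrals over finite products\<close>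

lemma product_sigma_finite_gamma_law: "product_sigma_finite (\<lambda>i. gamma_law (a i))"
  by (simp add: product_sigma_finite_def sigma_finite_gamma_law)

lemma product_sigma_finite_lborel: "product_sigma_finite (\<lambda>_. lborel)"
  by (simp add: product_sigma_finite_def lborel.sigma_finite_measure_axioms)

text \<open>Products of gamma, Lebesgue and uniform factors share one sigma-algebra, so
  measurability can be stated over \<open>borel\<close> throughout and carried between them.\<close>

lemma sets_PiM_borel_eq:
  assumes "\<And>i. i \<in> I \<Longrightarrow> sets (N i) = sets borel"
  shows "sets (Pi\<^sub>M I N) = sets (Pi\<^sub>M I (\<lambda>_. borel))"
  using assms by (intro sets_PiM_cong) auto

lemma sets_PiM_gamma_law [measurable_cong]:
  "sets (Pi\<^sub>M I (\<lambda>i. gamma_law (a i))) = sets (Pi\<^sub>M I (\<lambda>_. borel))"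
  by (intro sets_PiM_borel_eq) simp

lemma sets_PiM_lborel [measurable_cong]:
  "sets (Pi\<^sub>M I (\<lambda>_. lborel)) = sets (Pi\<^sub>M I (\<lambda>_. borel))"
  by (intro sets_PiM_borel_eq) simp

text \<open>Coordinates are split off one at a time. The density factors of the remaining ones are
  constant in the new coordinate and pass under the inner integral.\<close>

lemma nn_integral_PiM_gamma_law:
  assumes "finite I" "f \<in> borel_measurable (Pi\<^sub>M I (\<lambda>_. borel))"
  shows "(\<integral>\<^sup>+w. f w \<partial>Pi\<^sub>M I (\<lambda>i. gamma_law (a i))) =
    (\<integral>\<^sup>+w. ennreal (\<Prod>i\<in>I. gamma_dens (a i) (w i)) * f w \<partial>Pi\<^sub>M I (\<lambda>_. lborel))"
  using assms
proof (induction I arbitrary: f)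
  case empty
  show ?case by (simp add: PiM_empty nn_integral_count_space_finite)
next
  case (insert i I)
  note [measurable] = insert.prems
  note [simp] = insert.hyps
  interpret G: product_sigma_finite "\<lambda>i. gamma_law (a i)" by (rule product_sigma_finite_gamma_law)
  interpret L: product_sigma_finite "\<lambda>_. lborel" by (rule product_sigma_finite_lborel)
  interpret Gi: sigma_finite_measure "gamma_law (a i)" by (rule sigma_finite_gamma_law)
  have [measurable]: "(\<lambda>x. f ((fst x)(i := snd x))) \<in> borel_measurable (Pi\<^sub>M I (\<lambda>_. borel) \<Otimes>\<^sub>M borel)"
    by measurable
  have "(\<integral>\<^sup>+w. f w \<partial>Pi\<^sub>M (insert i I) (\<lambda>i. gamma_law (a i))) =
      (\<integral>\<^sup>+w. (\<integral>\<^sup>+y. f (w(i := y)) \<partial>gamma_law (a i)) \<partial>Pi\<^sub>M I (\<lambda>i. gamma_law (a i)))"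
    by (rule G.product_nn_integral_insert) (simp, simp, measurable)
  also have "\<dots> = (\<integral>\<^sup>+w. ennreal (\<Prod>i\<in>I. gamma_dens (a i) (w i)) *
      (\<integral>\<^sup>+y. f (w(i := y)) \<partial>gamma_law (a i)) \<partial>Pi\<^sub>M I (\<lambda>_. lborel))"
    by (rule insert.IH) measurable
  also have "\<dots> = (\<integral>\<^sup>+w. (\<integral>\<^sup>+y. ennreal (\<Prod>j\<in>insert i I. gamma_dens (a j) ((w(i := y)) j)) * f (w(i := y)) \<partial>lborel)
      \<partial>Pi\<^sub>M I (\<lambda>_. lborel))"
  proof (rule nn_integral_cong)
    fix w assume "w \<in> space (Pi\<^sub>M I (\<lambda>_. lborel::real measure))"
    then have w: "w \<in> space (Pi\<^sub>M I (\<lambda>_. borel))" by (simp add: space_PiM)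
    then have [measurable]: "(\<lambda>y. f (w(i := y))) \<in> borel_measurable borel" by measurable
    have p: "(\<Prod>j\<in>insert i I. gamma_dens (a j) ((w(i := y)) j)) =
        (\<Prod>j\<in>I. gamma_dens (a j) (w j)) * gamma_dens (a i) y" for y
    proof -
      have "(\<Prod>j\<in>I. gamma_dens (a j) ((w(i := y)) j)) = (\<Prod>j\<in>I. gamma_dens (a j) (w j))"
        by (intro prod.cong) auto
      then show ?thesis by (simp add: mult.commute)
    qed
    have "(\<integral>\<^sup>+y. ennreal (\<Prod>j\<in>insert i I. gamma_dens (a j) ((w(i := y)) j)) * f (w(i := y)) \<partial>lborel) =
      (\<integral>\<^sup>+y. ennreal (\<Prod>i\<in>I. gamma_dens (a i) (w i)) * (ennreal (gamma_dens (a i) y) * f (w(i := y))) \<partial>lborel)"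
      unfolding p by (simp add: ennreal_mult prod_nonneg mult.assoc)
    then show "ennreal (\<Prod>i\<in>I. gamma_dens (a i) (w i)) * (\<integral>\<^sup>+y. f (w(i := y)) \<partial>gamma_law (a i)) =
      (\<integral>\<^sup>+y. ennreal (\<Prod>j\<in>insert i I. gamma_dens (a j) ((w(i := y)) j)) * f (w(i := y)) \<partial>lborel)"
      by (simp add: nn_integral_gamma_law nn_integral_cmult)
  qed
  also have "\<dots> = (\<integral>\<^sup>+w. ennreal (\<Prod>j\<in>insert i I. gamma_dens (a j) (w j)) * f w
      \<partial>Pi\<^sub>M (insert i I) (\<lambda>_. lborel))"
    by (rule L.product_nn_integral_insert[symmetric]) (simp, simp, measurable)
  finally show ?case .
qed

text \<open>Each coordinate contributes one factor \<open>s\<close> by the one-dimensional affine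
  substitution; together they give the Jacobian of a dilation. The restriction to \<open>I\<close>
  keeps the scaled point in the extensional function space.\<close>

lemma nn_integral_PiM_lborel_scale:
  fixes s :: real
  assumes "finite I" "0 < s" "f \<in> borel_measurable (Pi\<^sub>M I (\<lambda>_. borel))"
  shows "(\<integral>\<^sup>+w. f w \<partial>Pi\<^sub>M I (\<lambda>_. lborel)) =
    ennreal (s ^ card I) * (\<integral>\<^sup>+v. f (\<lambda>i\<in>I. s * v i) \<partial>Pi\<^sub>M I (\<lambda>_. lborel))"
  using assms
proof (induction I arbitrary: f)
  case empty
  show ?case by (simp add: PiM_empty nn_integral_count_space_finite)
next
  case (insert i I)
  note [measurable] = insert.prems(2)
  note [simp] = insert.hyps
  interpret L: product_sigma_finite "\<lambda>_. lborel" by (rule product_sigma_finite_lborel)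
  let ?L = "\<lambda>I. Pi\<^sub>M I (\<lambda>_. lborel::real measure)"
  have [measurable]: "(\<lambda>x. f ((fst x)(i := snd x))) \<in> borel_measurable (Pi\<^sub>M I (\<lambda>_. borel) \<Otimes>\<^sub>M borel)"
    by measurable
  have [measurable]: "(\<lambda>x. f ((\<lambda>j\<in>I. s * fst x j)(i := s * snd x)))
      \<in> borel_measurable (Pi\<^sub>M I (\<lambda>_. borel) \<Otimes>\<^sub>M borel)"
    by measurable
  have "(\<integral>\<^sup>+w. f w \<partial>?L (insert i I)) = (\<integral>\<^sup>+w. (\<integral>\<^sup>+y. f (w(i := y)) \<partial>lborel) \<partial>?L I)"
    by (rule L.product_nn_integral_insert) (simp, simp, measurable)
  also have "\<dots> = ennreal (s ^ card I) *
      (\<integral>\<^sup>+w. (\<integral>\<^sup>+y. f ((\<lambda>j\<in>I. s * w j)(i := y)) \<partial>lborel) \<partial>?L I)"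
    by (rule insert.IH) (use insert.prems in \<open>simp, measurable\<close>)
  also have "(\<integral>\<^sup>+w. (\<integral>\<^sup>+y. f ((\<lambda>j\<in>I. s * w j)(i := y)) \<partial>lborel) \<partial>?L I) =
     (\<integral>\<^sup>+w. ennreal s * (\<integral>\<^sup>+y. f ((\<lambda>j\<in>I. s * w j)(i := s * y)) \<partial>lborel) \<partial>?L I)"
  proof (rule nn_integral_cong)
    fix w assume "w \<in> space (?L I)"
    have "(\<lambda>j\<in>I. s * w j) \<in> space (Pi\<^sub>M I (\<lambda>_. borel))" by (simp add: space_PiM)
    then have m: "(\<lambda>y. f ((\<lambda>j\<in>I. s * w j)(i := y))) \<in> borel_measurable borel" by measurable
    show "(\<integral>\<^sup>+y. f ((\<lambda>j\<in>I. s * w j)(i := y)) \<partial>lborel) =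
        ennreal s * (\<integral>\<^sup>+y. f ((\<lambda>j\<in>I. s * w j)(i := s * y)) \<partial>lborel)"
      using nn_integral_real_affine[OF m, of s 0] \<open>0 < s\<close>
      by (simp only: add_0 abs_of_pos less_imp_neq[symmetric] not_False_eq_True simp_thms)
  qed
  also have "\<dots> = ennreal s * (\<integral>\<^sup>+w. (\<integral>\<^sup>+y. f ((\<lambda>j\<in>I. s * w j)(i := s * y)) \<partial>lborel) \<partial>?L I)"
    by (rule nn_integral_cmult) measurable
  also have "(\<integral>\<^sup>+w. (\<integral>\<^sup>+y. f ((\<lambda>j\<in>I. s * w j)(i := s * y)) \<partial>lborel) \<partial>?L I) =
    (\<integral>\<^sup>+w. (\<integral>\<^sup>+y. f (\<lambda>j\<in>insert i I. s * (w(i := y)) j) \<partial>lborel) \<partial>?L I)"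
    by (intro nn_integral_cong arg_cong[where f = f]) (auto simp: fun_eq_iff)
  also have "\<dots> = (\<integral>\<^sup>+w. f (\<lambda>j\<in>insert i I. s * w j) \<partial>?L (insert i I))"
    by (rule L.product_nn_integral_insert[symmetric]) (simp, simp, measurable)
  finally show ?case
    using \<open>0 < s\<close> by (simp add: ennreal_mult mult_ac restrict_def)
qed

section \<open>Decomposing gamma vectors into total and proportions\<close>

text \<open>Pointwise core of the substitution by total \<open>s\<close> and proportions
  \<open>v\<close>, with Jacobian \<open>s ^ (r - 1)\<close>. Inside the simplex the exponentials
  merge into \<open>exp (- s)\<close> and the powers of \<open>s\<close> collect. Elsewhere,
  boundary included, both sides vanish, because \<open>gamma_dens\<close> is 0 at 0.\<close>

lemma gamma_dens_dirichlet_density: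
  fixes a :: "nat \<Rightarrow> nat" and v :: "nat \<Rightarrow> real"
  assumes r: "1 \<le> r" and s: "0 < s"
  shows "s ^ (r - 1) * ((\<Prod>j\<in>{1..<r}. gamma_dens (a j) (s * v j)) *
      gamma_dens (a r) (s * (1 - (\<Sum>j\<in>{1..<r}. v j)))) =
    gamma_dens ((\<Sum>j\<in>{1..r}. a j) + (r - 1)) s * dirichlet_density r (\<lambda>j. real (Suc (a j))) v"
proof (cases "(\<forall>j\<in>{1..<r}. 0 < v j) \<and> (\<Sum>j\<in>{1..<r}. v j) < 1")
  case False
  then have "(\<Prod>j\<in>{1..<r}. gamma_dens (a j) (s * v j)) = 0 \<or>
      gamma_dens (a r) (s * (1 - (\<Sum>j\<in>{1..<r}. v j))) = 0"
    using s by (auto simp: gamma_dens_def zero_less_mult_iff)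
  with False show ?thesis
    by (auto simp: dirichlet_density_def)
next
  case True
  define t where "t = 1 - (\<Sum>j\<in>{1..<r}. v j)"
  have t: "0 < t" using True by (simp add: t_def)
  have I: "{1..r} = insert r {1..<r}" using r by auto
  have A: "(\<Sum>j\<in>{1..r}. a j) = (\<Sum>j\<in>{1..<r}. a j) + a r" unfolding I by simp
  have G: "Gamma (real (Suc n)) = fact n" for n
    using Gamma_fact[of n, where 'a = real] by (simp add: add_ac)
  \<comment> \<open>The \<open>r\<close> successors add \<open>r\<close> to the sum; writing this as
    a successor of \<open>r - 1\<close> more turns the Gamma value into a factorial.\<close>
  have "(\<Sum>j\<in>{1..r}. real (Suc (a j))) = real (Suc ((\<Sum>j\<in>{1..r}. a j) + (r - 1)))"
    using r by (simp add: sum.distrib)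
  then have G1: "Gamma (\<Sum>j\<in>{1..r}. real (Suc (a j))) = fact ((\<Sum>j\<in>{1..r}. a j) + (r - 1))"
    by (simp only: G)
  have P: "(\<Prod>j\<in>{1..<r}. v j powr (real (Suc (a j)) - 1)) = (\<Prod>j\<in>{1..<r}. v j ^ a j)"
    using True by (intro prod.cong) (auto simp: powr_realpow)
  have PI: "(\<Prod>j\<in>{1..r}. fact (a j) :: real) = fact (a r) * (\<Prod>j\<in>{1..<r}. fact (a j))"
    unfolding I by simp
  have D: "dirichlet_density r (\<lambda>j. real (Suc (a j))) v =
      fact ((\<Sum>j\<in>{1..r}. a j) + (r - 1)) / ((\<Prod>j\<in>{1..<r}. fact (a j)) * fact (a r)) *
      ((\<Prod>j\<in>{1..<r}. v j ^ a j) * t ^ a r)"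
    unfolding dirichlet_density_def G1 P G t_def[symmetric] using True t
    by (simp add: PI powr_realpow mult.commute del: One_nat_def)
  have "(\<Prod>j\<in>{1..<r}. gamma_dens (a j) (s * v j)) =
      (\<Prod>j\<in>{1..<r}. s ^ a j * v j ^ a j * exp (- (s * v j)) / fact (a j))"
    using True s by (intro prod.cong) (auto simp: gamma_dens_def power_mult_distrib)
  also have "\<dots> = s ^ (\<Sum>j\<in>{1..<r}. a j) * (\<Prod>j\<in>{1..<r}. v j ^ a j) *
      exp (- s * (\<Sum>j\<in>{1..<r}. v j)) / (\<Prod>j\<in>{1..<r}. fact (a j))"
    by (simp add: prod.distrib prod_dividef power_sum exp_sum[symmetric] sum_negf sum_distrib_left)
  finally have Q: "(\<Prod>j\<in>{1..<r}. gamma_dens (a j) (s * v j)) = \<dots>" .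
  \<comment> \<open>The proportions \<open>v\<close> together with \<open>t\<close> sum to 1, so the
    exponents on the right add up to \<open>- s\<close>.\<close>
  have E: "exp (- s) = exp (- s * (\<Sum>j\<in>{1..<r}. v j)) * exp (- (s * t))"
    by (simp add: exp_add[symmetric] t_def algebra_simps)
  have F: "(\<Prod>j\<in>{1..<r}. fact (a j) :: real) \<noteq> 0" by simp
  show ?thesis
    unfolding D Q t_def[symmetric] gamma_dens_def[of _ s] gamma_dens_def[of _ "s * t"] E A
    using s t F by (simp add: power_add power_mult_distrib field_simps)
qed


lemma borel_measurable_dirichlet_density [measurable]:
  "dirichlet_density r \<alpha> \<in> borel_measurable (Pi\<^sub>M {1..<r} (\<lambda>_. borel))"
  unfolding dirichlet_density_def by measurable

text \<open>The density only concerns the first \<open>r - 1\<close> weights; this restores the last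
  one. A function update is used so that an extensional function on \<open>{1..<r}\<close> becomes
  an extensional one on \<open>{1..r}\<close>.\<close>

definition complete_simplex :: "nat \<Rightarrow> (nat \<Rightarrow> real) \<Rightarrow> nat \<Rightarrow> real" where
  "complete_simplex r v = v(r := 1 - (\<Sum>j\<in>{1..<r}. v j))"

lemma sum_complete_simplex:
  assumes "1 \<le> r"
  shows "(\<Sum>j\<in>{1..r}. complete_simplex r v j) = 1"
proof -
  have "{1..r} = insert r {1..<r}" using assms by auto
  then show ?thesis by (simp add: complete_simplex_def)
qed

lemma measurable_complete_simplex [measurable]:
  assumes "1 \<le> r"
  shows "complete_simplex r \<in> measurable (Pi\<^sub>M {1..<r} (\<lambda>_. borel)) (Pi\<^sub>M {1..r} (\<lambda>_. borel))"
  unfolding complete_simplex_def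
  by (rule measurable_fun_upd[where J = "{1..<r}"]) (use assms in \<open>auto simp: le_less\<close>)

text \<open>The iterated integral expresses that the total and the proportions are independent,
  gamma and Dirichlet distributed. Since \<open>gamma_law\<close> is indexed by shape minus one, the
  index of the total, plus one, is the sum of all \<open>Suc (a j)\<close>.\<close>

lemma nn_integral_gamma_dirichlet:
  fixes a :: "nat \<Rightarrow> nat"
  assumes r: "1 \<le> r" and f [measurable]: "f \<in> borel_measurable (Pi\<^sub>M {1..r} (\<lambda>_. borel))"
  shows "(\<integral>\<^sup>+w. f w \<partial>Pi\<^sub>M {1..r} (\<lambda>i. gamma_law (a i))) =
    (\<integral>\<^sup>+s. (\<integral>\<^sup>+v. ennreal (dirichlet_density r (\<lambda>j. real (Suc (a j))) v) *
       f (\<lambda>j\<in>{1..r}. s * complete_simplex r v j) \<partial>Pi\<^sub>M {1..<r} (\<lambda>_. lborel))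
     \<partial>gamma_law ((\<Sum>j\<in>{1..r}. a j) + (r - 1)))"
proof -
  let ?J = "{1..<r}"
  let ?L = "Pi\<^sub>M ?J (\<lambda>_. lborel::real measure)"
  let ?B = "Pi\<^sub>M ?J (\<lambda>_. borel::real measure)"
  let ?P = "\<lambda>u. \<Prod>j\<in>?J. gamma_dens (a j) (u j)"
  let ?D = "dirichlet_density r (\<lambda>j. real (Suc (a j)))"
  let ?N = "(\<Sum>j\<in>{1..r}. a j) + (r - 1)"
  have I: "{1..r} = insert r ?J" using r by auto
  note [measurable] = measurable_complete_simplex[OF r]
  interpret L: product_sigma_finite "\<lambda>_::nat. lborel::real measure" by (rule product_sigma_finite_lborel)
  interpret FL: finite_product_sigma_finite "\<lambda>_. lborel" ?J by unfold_locales simp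
  interpret PL: pair_sigma_finite lborel ?L by unfold_locales
  have [measurable]: "f \<in> borel_measurable (Pi\<^sub>M (insert r ?J) (\<lambda>_. borel))"
    using f by (simp only: I)
  have [measurable]: "(\<lambda>x. f ((fst x)(r := snd x))) \<in> borel_measurable (?B \<Otimes>\<^sub>M borel)"
    by measurable
  have "(\<lambda>x. (fst x)(r := snd x - (\<Sum>j\<in>?J. fst x j))) \<in> measurable (?B \<Otimes>\<^sub>M borel) (Pi\<^sub>M {1..r} (\<lambda>_. borel))"
    by (rule measurable_fun_upd[where J = ?J]) (use r in \<open>auto simp: le_less\<close>)
  from measurable_compose[OF this f]
  have [measurable]: "(\<lambda>x. f ((fst x)(r := snd x - (\<Sum>j\<in>?J. fst x j)))) \<in> borel_measurable (?B \<Otimes>\<^sub>M borel)" .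
  have [measurable]: "(\<lambda>x. f (\<lambda>j\<in>{1..r}. fst x * complete_simplex r (snd x) j))
      \<in> borel_measurable (borel \<Otimes>\<^sub>M ?B)"
    by measurable
  have "(\<integral>\<^sup>+w. f w \<partial>Pi\<^sub>M {1..r} (\<lambda>i. gamma_law (a i))) =
      (\<integral>\<^sup>+w. ennreal (\<Prod>i\<in>insert r ?J. gamma_dens (a i) (w i)) * f w \<partial>Pi\<^sub>M (insert r ?J) (\<lambda>_. lborel))"
    unfolding I by (rule nn_integral_PiM_gamma_law) (simp, measurable)
  also have "\<dots> = (\<integral>\<^sup>+u. (\<integral>\<^sup>+y. ennreal (\<Prod>i\<in>insert r ?J. gamma_dens (a i) ((u(r := y)) i)) * f (u(r := y)) \<partial>lborel) \<partial>?L)"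
    by (rule L.product_nn_integral_insert) (simp, simp, measurable)
  \<comment> \<open>For fixed \<open>u\<close>, the last coordinate is traded for the total
    \<open>s\<close> by a translation.\<close>
  also have "\<dots> = (\<integral>\<^sup>+u. (\<integral>\<^sup>+s. ennreal (?P u * gamma_dens (a r) (s - sum u ?J)) *
      f (u(r := s - sum u ?J)) \<partial>lborel) \<partial>?L)"
  proof (rule nn_integral_cong)
    fix u assume "u \<in> space ?L"
    then have u: "u \<in> space ?B" by (simp add: space_PiM)
    then have [measurable]: "(\<lambda>y. f (u(r := y))) \<in> borel_measurable borel" by measurable
    have p: "(\<Prod>i\<in>insert r ?J. gamma_dens (a i) ((u(r := y)) i)) = ?P u * gamma_dens (a r) y" for y
    proof -
      have "(\<Prod>i\<in>?J. gamma_dens (a i) ((u(r := y)) i)) = ?P u"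
        by (intro prod.cong) auto
      then show ?thesis by (simp add: mult.commute)
    qed
    show "(\<integral>\<^sup>+y. ennreal (\<Prod>i\<in>insert r ?J. gamma_dens (a i) ((u(r := y)) i)) * f (u(r := y)) \<partial>lborel) =
      (\<integral>\<^sup>+s. ennreal (?P u * gamma_dens (a r) (s - sum u ?J)) * f (u(r := s - sum u ?J)) \<partial>lborel)"
      unfolding p by (subst nn_integral_real_affine[where c = 1 and t = "- sum u ?J"]) auto
  qed
  \<comment> \<open>With \<open>s\<close> outermost it is fixed below, and the remaining coordinates
    can be rescaled by it.\<close>
  also have "\<dots> = (\<integral>\<^sup>+s. (\<integral>\<^sup>+u. ennreal (?P u * gamma_dens (a r) (s - sum u ?J)) *
      f (u(r := s - sum u ?J)) \<partial>?L) \<partial>lborel)"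
    by (rule PL.Fubini') measurable
  also have "\<dots> = (\<integral>\<^sup>+s. ennreal (gamma_dens ?N s) *
      (\<integral>\<^sup>+v. ennreal (?D v) * f (\<lambda>j\<in>{1..r}. s * complete_simplex r v j) \<partial>?L) \<partial>lborel)"
  proof (rule nn_integral_cong)
    fix s :: real
    show "(\<integral>\<^sup>+u. ennreal (?P u * gamma_dens (a r) (s - sum u ?J)) * f (u(r := s - sum u ?J)) \<partial>?L) =
      ennreal (gamma_dens ?N s) * (\<integral>\<^sup>+v. ennreal (?D v) * f (\<lambda>j\<in>{1..r}. s * complete_simplex r v j) \<partial>?L)"
    proof (cases "0 < s")
      case False
      \<comment> \<open>If all \<open>u j\<close> are positive and the total is not, then the last
        coordinate \<open>s - sum u ?J\<close> cannot be positive; so some gamma factor is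
        0.\<close>
      have z: "?P u * gamma_dens (a r) (s - sum u ?J) = 0" for u
      proof (cases "\<forall>j\<in>?J. 0 < u j")
        case True
        then have "0 \<le> sum u ?J" by (intro sum_nonneg) (auto simp: less_imp_le)
        with False show ?thesis by (simp add: gamma_dens_def)
      qed (auto simp: gamma_dens_def)
      show ?thesis using False by (simp add: z gamma_dens_def[of _ s] del: One_nat_def)
    next
      case True
      have [measurable]: "(\<lambda>v. f (\<lambda>j\<in>{1..r}. s * complete_simplex r v j)) \<in> borel_measurable ?B"
        by measurable
      \<comment> \<open>Substitution of \<open>s * v\<close> for \<open>u\<close>, which passes from
        coordinates to proportions.\<close>
      have "(\<integral>\<^sup>+u. ennreal (?P u * gamma_dens (a r) (s - sum u ?J)) * f (u(r := s - sum u ?J)) \<partial>?L) =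
        ennreal (s ^ card ?J) * (\<integral>\<^sup>+v. ennreal (?P (\<lambda>j\<in>?J. s * v j) * gamma_dens (a r) (s - (\<Sum>j\<in>?J. (\<lambda>j\<in>?J. s * v j) j))) *
          f ((\<lambda>j\<in>?J. s * v j)(r := s - (\<Sum>j\<in>?J. (\<lambda>j\<in>?J. s * v j) j))) \<partial>?L)"
        by (rule nn_integral_PiM_lborel_scale) (use True in \<open>simp, simp, measurable\<close>)
      also have "\<dots> = ennreal (s ^ (r - 1)) * (\<integral>\<^sup>+v. ennreal ((\<Prod>j\<in>?J. gamma_dens (a j) (s * v j)) *
          gamma_dens (a r) (s * (1 - sum v ?J))) * f (\<lambda>j\<in>{1..r}. s * complete_simplex r v j) \<partial>?L)"
      proof -
        have "(\<lambda>j\<in>?J. s * v j)(r := s - (\<Sum>j\<in>?J. (\<lambda>j\<in>?J. s * v j) j)) =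
            (\<lambda>j\<in>{1..r}. s * complete_simplex r v j)" for v
          using r by (auto simp: fun_eq_iff complete_simplex_def sum_distrib_left algebra_simps)
        moreover have "?P (\<lambda>j\<in>?J. s * v j) * gamma_dens (a r) (s - (\<Sum>j\<in>?J. (\<lambda>j\<in>?J. s * v j) j)) =
            (\<Prod>j\<in>?J. gamma_dens (a j) (s * v j)) * gamma_dens (a r) (s * (1 - sum v ?J))" for v
          by (simp add: sum_distrib_left algebra_simps)
        ultimately show ?thesis by (simp only: card_atLeastLessThan)
      qed
      also have "\<dots> = (\<integral>\<^sup>+v. ennreal (gamma_dens ?N s) * (ennreal (?D v) *
          f (\<lambda>j\<in>{1..r}. s * complete_simplex r v j)) \<partial>?L)"
      proof (subst nn_integral_cmult[symmetric], measurable, rule nn_integral_cong)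
        fix v
        \<comment> \<open>\<open>ennreal_mult\<close> asks for nonnegative factors, so the sign of
          the Dirichlet density is settled before the real identity is transferred.\<close>
        have "0 < (\<Sum>j\<in>{1..r}. real (Suc (a j)))"
          using r by (intro sum_pos) auto
        then have "0 \<le> ?D v"
          by (auto simp: dirichlet_density_def simp del: One_nat_def of_nat_Suc intro!: mult_nonneg_nonneg divide_nonneg_nonneg
              Gamma_real_nonneg prod_nonneg sum_nonneg)
        then show "ennreal (s ^ (r - 1)) * (ennreal ((\<Prod>j\<in>?J. gamma_dens (a j) (s * v j)) *
          gamma_dens (a r) (s * (1 - sum v ?J))) * f (\<lambda>j\<in>{1..r}. s * complete_simplex r v j)) =
          ennreal (gamma_dens ?N s) * (ennreal (?D v) * f (\<lambda>j\<in>{1..r}. s * complete_simplex r v j))"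
          using gamma_dens_dirichlet_density[OF r True, of a v] True
          by (simp only: mult.assoc[symmetric] ennreal_mult[symmetric] gamma_dens_nonneg prod_nonneg
              zero_le_power less_imp_le mult_nonneg_nonneg)
      qed
      also have "\<dots> = ennreal (gamma_dens ?N s) *
          (\<integral>\<^sup>+v. ennreal (?D v) * f (\<lambda>j\<in>{1..r}. s * complete_simplex r v j) \<partial>?L)"
        by (rule nn_integral_cmult) measurable
      finally show ?thesis .
    qed
  qed
  also have "\<dots> = (\<integral>\<^sup>+s. (\<integral>\<^sup>+v. ennreal (?D v) * f (\<lambda>j\<in>{1..r}. s * complete_simplex r v j) \<partial>?L) \<partial>gamma_law ?N)"
    by (rule nn_integral_gamma_law[symmetric]) measurable
  finally show ?thesis .
qed

section \<open>Beta laws as ratios of gamma variables\<close>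

lemma borel_measurable_beta_density [measurable]: "beta_density p q \<in> borel_measurable borel"
  unfolding beta_density_def by measurable

text \<open>Makes the facts on Beta laws instances of the Dirichlet decomposition with two
  coordinates.\<close>

lemma beta_density_dirichlet_density:
  "dirichlet_density 2 (\<lambda>j. if j = 1 then p else q) v = beta_density p q (v 1)"
proof -
  have "{1..<2::nat} = {1}" "{1..2::nat} = {1, 2}" by auto
  then show ?thesis
    by (auto simp: dirichlet_density_def beta_density_def simp del: One_nat_def)
qed

text \<open>Case \<open>r = 2\<close> of the decomposition: for independent gamma variables the
  ratio of the first to the total is Beta distributed and independent of the total.\<close>

lemma nn_integral_gamma_beta:
  fixes f :: "real \<times> real \<Rightarrow> ennreal"
  assumes [measurable]: "f \<in> borel_measurable (borel \<Otimes>\<^sub>M borel)"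
  shows "(\<integral>\<^sup>+x. (\<integral>\<^sup>+y. f (x, y) \<partial>gamma_law m) \<partial>gamma_law k) =
    (\<integral>\<^sup>+s. (\<integral>\<^sup>+z. ennreal (beta_density (real (Suc k)) (real (Suc m)) z) *
       f (s * z, s * (1 - z)) \<partial>lborel) \<partial>gamma_law (k + m + 1))"
proof -
  define a where "a = (\<lambda>j::nat. if j = 1 then k else m)"
  interpret G: product_sigma_finite "\<lambda>i. gamma_law (a i)" by (rule product_sigma_finite_gamma_law)
  interpret L: product_sigma_finite "\<lambda>_::nat. lborel::real measure" by (rule product_sigma_finite_lborel)
  interpret G2: sigma_finite_measure "gamma_law m" by (rule sigma_finite_gamma_law)
  have I: "{1..2::nat} = insert 2 {1}" and J: "{1..<2::nat} = {1}" by auto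
  have a: "a 1 = k" "a 2 = m" "(\<lambda>j. real (Suc (a j))) = (\<lambda>j. if j = 1 then real (Suc k) else real (Suc m))"
    by (auto simp: a_def)
  have N: "(\<Sum>j\<in>{1..2}. a j) + (2 - 1) = k + m + 1"
    unfolding I using a by simp
  have "(\<integral>\<^sup>+x. (\<integral>\<^sup>+y. f (x, y) \<partial>gamma_law m) \<partial>gamma_law k) =
      (\<integral>\<^sup>+x. (\<integral>\<^sup>+y. f (x 1, y) \<partial>gamma_law m) \<partial>Pi\<^sub>M {1} (\<lambda>i. gamma_law (a i)))"
    using G.product_nn_integral_singleton[of "\<lambda>x. \<integral>\<^sup>+y. f (x, y) \<partial>gamma_law m" 1]
    by (simp add: a del: One_nat_def)
  also have "\<dots> = (\<integral>\<^sup>+w. f (w 1, w 2) \<partial>Pi\<^sub>M {1..2} (\<lambda>i. gamma_law (a i)))"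
    unfolding I by (subst G.product_nn_integral_insert) (simp_all add: a del: One_nat_def)
  also have "\<dots> = (\<integral>\<^sup>+s. (\<integral>\<^sup>+v. ennreal (beta_density (real (Suc k)) (real (Suc m)) (v 1)) *
      f (s * v 1, s * (1 - v 1)) \<partial>Pi\<^sub>M {1::nat} (\<lambda>_. lborel)) \<partial>gamma_law (k + m + 1))"
    by (subst nn_integral_gamma_dirichlet)
      (simp_all only: N J a beta_density_dirichlet_density, auto simp: complete_simplex_def J simp del: One_nat_def)
  also have "\<dots> = (\<integral>\<^sup>+s. (\<integral>\<^sup>+z. ennreal (beta_density (real (Suc k)) (real (Suc m)) z) *
       f (s * z, s * (1 - z)) \<partial>lborel) \<partial>gamma_law (k + m + 1))"
    by (intro nn_integral_cong L.product_nn_integral_singleton) measurable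
  finally show ?thesis .
qed

text \<open>The integrand 1 in the previous decomposition gives the normalisation, since all gamma
  laws involved have mass 1; no Beta integral is computed.\<close>

lemma nn_integral_beta_density:
  "(\<integral>\<^sup>+z. ennreal (beta_density (real (Suc k)) (real (Suc m)) z) \<partial>lborel) = 1"
proof -
  interpret K: prob_space "gamma_law k" by (rule prob_space_gamma_law)
  interpret M: prob_space "gamma_law m" by (rule prob_space_gamma_law)
  interpret N: prob_space "gamma_law (k + m + 1)" by (rule prob_space_gamma_law)
  show ?thesis
    using nn_integral_gamma_beta[of "\<lambda>_. 1" k m]
      K.emeasure_space_1 M.emeasure_space_1 N.emeasure_space_1 by simp
qed

text \<open>A function of the total does not see the ratio, whose density integrates to 1.\<close>

lemma nn_integral_gamma_law_add:
  assumes [measurable]: "f \<in> borel_measurable borel"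
  shows "(\<integral>\<^sup>+x. (\<integral>\<^sup>+y. f (x + y) \<partial>gamma_law m) \<partial>gamma_law k) = (\<integral>\<^sup>+s. f s \<partial>gamma_law (k + m + 1))"
proof -
  have "(\<integral>\<^sup>+x. (\<integral>\<^sup>+y. f (x + y) \<partial>gamma_law m) \<partial>gamma_law k) =
      (\<integral>\<^sup>+s. (\<integral>\<^sup>+z. ennreal (beta_density (real (Suc k)) (real (Suc m)) z) * f s \<partial>lborel) \<partial>gamma_law (k + m + 1))"
    using nn_integral_gamma_beta[of "\<lambda>p. f (fst p + snd p)" k m] by (simp add: algebra_simps del: of_nat_Suc)
  then show ?thesis
    by (simp add: nn_integral_multc nn_integral_beta_density del: of_nat_Suc)
qed

section \<open>Uniform averages with gamma weights\<close>

abbreviation (input) "unif \<equiv> uniform_measure lborel {0<..<1::real}"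

text \<open>The uniform law is Beta(1, 1), so this is the decomposition of two standard
  exponentials, read from right to left: a total of shape 2 is cut at a uniform ratio.\<close>

lemma nn_integral_gamma_split:
  fixes f :: "real \<times> real \<Rightarrow> ennreal"
  assumes [measurable]: "f \<in> borel_measurable (borel \<Otimes>\<^sub>M borel)"
  shows "(\<integral>\<^sup>+w. (\<integral>\<^sup>+x. f (w * x, w * (1 - x)) \<partial>unif) \<partial>gamma_law 1) =
    (\<integral>\<^sup>+x. (\<integral>\<^sup>+y. f (x, y) \<partial>gamma_law 0) \<partial>gamma_law 0)"
proof -
  have "ennreal (beta_density 1 1 z) = indicator {0<..<1} z" for z
    by (auto simp: beta_density_def indicator_def Gamma_numeral)
  then show ?thesis
    using nn_integral_gamma_beta[of f 0 0] by (simp add: nn_integral_uniform_measure mult.commute divide_ennreal_def)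
qed


lemma prob_space_unif: "prob_space unif"
  by (rule prob_space_uniform_measure) auto

lemma sigma_finite_unif: "sigma_finite_measure unif"
proof -
  interpret prob_space unif by (rule prob_space_unif)
  show ?thesis by unfold_locales
qed

lemma product_sigma_finite_unif: "product_sigma_finite (\<lambda>_. unif)"
  by (simp add: product_sigma_finite_def sigma_finite_unif)

lemma sets_PiM_unif [measurable_cong]:
  "sets (Pi\<^sub>M I (\<lambda>_. unif)) = sets (Pi\<^sub>M I (\<lambda>_. borel))"
  by (intro sets_PiM_borel_eq) simp

text \<open>Each index contributes an independent pair of exponentials, and each component of the
  pair raises the shape of one sum by 1. The claim is kept for arbitrary \<open>f\<close> because
  the induction hypothesis is applied to a smoothed function.\<close>

lemma nn_integral_gamma_average:
  fixes f :: "real \<times> real \<Rightarrow> ennreal" and I :: "'i set"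
  assumes "finite I" "I \<noteq> {}" "f \<in> borel_measurable (borel \<Otimes>\<^sub>M borel)"
  shows "(\<integral>\<^sup>+w. (\<integral>\<^sup>+x. f (\<Sum>i\<in>I. w i * x i, \<Sum>i\<in>I. w i * (1 - x i))
      \<partial>Pi\<^sub>M I (\<lambda>_. unif)) \<partial>Pi\<^sub>M I (\<lambda>_. gamma_law 1)) =
    (\<integral>\<^sup>+a. (\<integral>\<^sup>+b. f (a, b) \<partial>gamma_law (card I - 1)) \<partial>gamma_law (card I - 1))"
  using assms
proof (induction I arbitrary: f rule: finite_ne_induct)
  case (singleton i)
  note [measurable] = singleton.prems
  interpret G: product_sigma_finite "\<lambda>_. gamma_law 1" by (rule product_sigma_finite_gamma_law)
  interpret U: product_sigma_finite "\<lambda>_. unif" by (rule product_sigma_finite_unif)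
  interpret U1: sigma_finite_measure unif by (rule sigma_finite_unif)
  have "(\<integral>\<^sup>+w. (\<integral>\<^sup>+x. f (w i * x i, w i * (1 - x i)) \<partial>Pi\<^sub>M {i} (\<lambda>_. unif)) \<partial>Pi\<^sub>M {i} (\<lambda>_. gamma_law 1)) =
    (\<integral>\<^sup>+w. (\<integral>\<^sup>+x. f (w i * x, w i * (1 - x)) \<partial>unif) \<partial>Pi\<^sub>M {i} (\<lambda>_. gamma_law 1))"
    by (intro nn_integral_cong U.product_nn_integral_singleton) measurable
  also have "\<dots> = (\<integral>\<^sup>+w. (\<integral>\<^sup>+x. f (w * x, w * (1 - x)) \<partial>unif) \<partial>gamma_law 1)"
    by (rule G.product_nn_integral_singleton) measurable
  finally show ?case
    using nn_integral_gamma_split[OF singleton.prems] by simp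
next
  case (insert i I)
  note [measurable] = insert.prems
  note [simp] = insert.hyps
  interpret G: product_sigma_finite "\<lambda>_. gamma_law 1" by (rule product_sigma_finite_gamma_law)
  interpret U: product_sigma_finite "\<lambda>_. unif" by (rule product_sigma_finite_unif)
  interpret U1: sigma_finite_measure unif by (rule sigma_finite_unif)
  interpret G1: sigma_finite_measure "gamma_law 1" by (rule sigma_finite_gamma_law)
  interpret FU: finite_product_sigma_finite "\<lambda>_. unif" I by unfold_locales simp
  interpret FU': finite_product_sigma_finite "\<lambda>_. unif" "insert i I" by unfold_locales simp
  interpret P: pair_sigma_finite "gamma_law 1" "Pi\<^sub>M I (\<lambda>_. unif)" by unfold_locales
  let ?n = "card I - 1"
  let ?W = "\<lambda>I. Pi\<^sub>M I (\<lambda>_. gamma_law 1)" and ?X = "\<lambda>I. Pi\<^sub>M I (\<lambda>_. unif)"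
  interpret N: sigma_finite_measure "gamma_law ?n" by (rule sigma_finite_gamma_law)
  interpret Z: sigma_finite_measure "gamma_law 0" by (rule sigma_finite_gamma_law)
  interpret S: sigma_finite_measure "gamma_law (?n + 0 + 1)" by (rule sigma_finite_gamma_law)
  interpret Q: pair_sigma_finite "gamma_law 0" "gamma_law ?n" by unfold_locales
  \<comment> \<open>Written in the form that additivity of gamma laws produces; a nonempty
    \<open>I\<close> makes the truncated subtraction exact.\<close>
  have n: "card (insert i I) - 1 = ?n + 0 + 1"
    using insert.hyps by (simp add: card_gt_0_iff)
  \<comment> \<open>\<open>g\<close> is \<open>f\<close> averaged over the exponential pair of the
    new index; the induction hypothesis is used for \<open>g\<close>.\<close>
  define g where "g = (\<lambda>(a, b). \<integral>\<^sup>+c. (\<integral>\<^sup>+d. f (a + c, b + d) \<partial>gamma_law 0) \<partial>gamma_law 0)"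
  have [measurable]: "g \<in> borel_measurable (borel \<Otimes>\<^sub>M borel)"
    unfolding g_def by measurable
  have g_eq: "g (a, b) = (\<integral>\<^sup>+w. (\<integral>\<^sup>+x. f (a + w * x, b + w * (1 - x)) \<partial>unif) \<partial>gamma_law 1)" for a b
    unfolding g_def
    using nn_integral_gamma_split[of "\<lambda>p. f (a + fst p, b + snd p)"] by simp
  have "(\<integral>\<^sup>+w. (\<integral>\<^sup>+x. f (\<Sum>i\<in>insert i I. w i * x i, \<Sum>i\<in>insert i I. w i * (1 - x i)) \<partial>?X (insert i I)) \<partial>?W (insert i I)) =
    (\<integral>\<^sup>+w. (\<integral>\<^sup>+w'. (\<integral>\<^sup>+x. f (\<Sum>j\<in>insert i I. (w(i := w')) j * x j, \<Sum>j\<in>insert i I. (w(i := w')) j * (1 - x j))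
       \<partial>?X (insert i I)) \<partial>gamma_law 1) \<partial>?W I)"
    by (rule G.product_nn_integral_insert) (simp, simp, measurable)
  also have "\<dots> = (\<integral>\<^sup>+w. (\<integral>\<^sup>+w'. (\<integral>\<^sup>+x. (\<integral>\<^sup>+x'. f ((\<Sum>j\<in>I. w j * x j) + w' * x', (\<Sum>j\<in>I. w j * (1 - x j)) + w' * (1 - x'))
       \<partial>unif) \<partial>?X I) \<partial>gamma_law 1) \<partial>?W I)"
  proof (intro nn_integral_cong)
    fix w :: "'i \<Rightarrow> real" and w' :: real
    have s1: "(\<Sum>j\<in>insert i I. (w(i := w')) j * (x(i := x')) j) = (\<Sum>j\<in>I. w j * x j) + w' * x'" for x x'
    proof -
      have "(\<Sum>j\<in>I. (w(i := w')) j * (x(i := x')) j) = (\<Sum>j\<in>I. w j * x j)"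
        by (intro sum.cong) auto
      then show ?thesis by (simp add: add.commute)
    qed
    have s2: "(\<Sum>j\<in>insert i I. (w(i := w')) j * (1 - (x(i := x')) j)) = (\<Sum>j\<in>I. w j * (1 - x j)) + w' * (1 - x')" for x x'
    proof -
      have "(\<Sum>j\<in>I. (w(i := w')) j * (1 - (x(i := x')) j)) = (\<Sum>j\<in>I. w j * (1 - x j))"
        by (intro sum.cong) auto
      then show ?thesis by (simp add: add.commute)
    qed
    show "(\<integral>\<^sup>+x. f (\<Sum>j\<in>insert i I. (w(i := w')) j * x j, \<Sum>j\<in>insert i I. (w(i := w')) j * (1 - x j)) \<partial>?X (insert i I)) =
      (\<integral>\<^sup>+x. (\<integral>\<^sup>+x'. f ((\<Sum>j\<in>I. w j * x j) + w' * x', (\<Sum>j\<in>I. w j * (1 - x j)) + w' * (1 - x')) \<partial>unif) \<partial>?X I)"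
      by (subst U.product_nn_integral_insert) (simp, simp, measurable, simp only: s1 s2)
  qed
  \<comment> \<open>The weight of the new index is moved inside the integral over the old uniforms,
    next to its own uniform, where the pair forms \<open>g\<close>.\<close>
  also have "\<dots> = (\<integral>\<^sup>+w. (\<integral>\<^sup>+x. g (\<Sum>j\<in>I. w j * x j, \<Sum>j\<in>I. w j * (1 - x j)) \<partial>?X I) \<partial>?W I)"
    unfolding g_eq by (intro nn_integral_cong P.Fubini'[symmetric]) measurable
  also have "\<dots> = (\<integral>\<^sup>+a. (\<integral>\<^sup>+b. g (a, b) \<partial>gamma_law ?n) \<partial>gamma_law ?n)"
    by (rule insert.IH) measurable
  \<comment> \<open>Exchanging \<open>b\<close> and \<open>c\<close> puts \<open>d\<close> next to
    \<open>b\<close>; once \<open>b + d\<close> is absorbed, \<open>c\<close> is next to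
    \<open>a\<close>.\<close>
  also have "\<dots> = (\<integral>\<^sup>+a. (\<integral>\<^sup>+c. (\<integral>\<^sup>+b. (\<integral>\<^sup>+d. f (a + c, b + d) \<partial>gamma_law 0) \<partial>gamma_law ?n) \<partial>gamma_law 0) \<partial>gamma_law ?n)"
    unfolding g_def prod.case by (intro nn_integral_cong Q.Fubini') measurable
  also have "\<dots> = (\<integral>\<^sup>+a. (\<integral>\<^sup>+c. (\<integral>\<^sup>+b. f (a + c, b) \<partial>gamma_law (?n + 0 + 1)) \<partial>gamma_law 0) \<partial>gamma_law ?n)"
    by (intro nn_integral_cong nn_integral_gamma_law_add) measurable
  also have "\<dots> = (\<integral>\<^sup>+a. (\<integral>\<^sup>+b. f (a, b) \<partial>gamma_law (?n + 0 + 1)) \<partial>gamma_law (?n + 0 + 1))"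
    by (rule nn_integral_gamma_law_add) measurable
  finally show ?case unfolding n .
qed

section \<open>The law of the randomly weighted average\<close>

text \<open>The quotient \<open>a / (a + b)\<close> is invariant under scaling, so the total
  integrates out both when gamma weights are normalised to Dirichlet weights and when the two
  resulting gamma sums are replaced by their ratio.\<close>

lemma nn_integral_dirichlet_average:
  fixes h :: "real \<Rightarrow> ennreal"
  assumes r: "1 \<le> r" and h [measurable]: "h \<in> borel_measurable borel"
  shows "(\<integral>\<^sup>+v. ennreal (dirichlet_density r (\<lambda>_. 2) v) *
      (\<integral>\<^sup>+x. h (\<Sum>j\<in>{1..r}. complete_simplex r v j * x j) \<partial>Pi\<^sub>M {1..r} (\<lambda>_. unif)) \<partial>Pi\<^sub>M {1..<r} (\<lambda>_. lborel)) =
    (\<integral>\<^sup>+z. ennreal (beta_density (real r) (real r) z) * h z \<partial>lborel)"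
    (is "?lhs = ?rhs")
proof -
  let ?N = "(\<Sum>j\<in>{1..r}. 1) + (r - 1)"
  let ?U = "Pi\<^sub>M {1..r} (\<lambda>_. unif)"
  define q where "q = (\<lambda>(a, b). h (a / (a + b)))"
  have q [measurable]: "q \<in> borel_measurable (borel \<Otimes>\<^sub>M borel)"
    unfolding q_def by measurable
  interpret U: product_sigma_finite "\<lambda>_. unif" by (rule product_sigma_finite_unif)
  interpret FU: finite_product_sigma_finite "\<lambda>_. unif" "{1..r}" by unfold_locales simp
  define Q where "Q w = (\<integral>\<^sup>+x. q (\<Sum>i\<in>{1..r}. w i * x i, \<Sum>i\<in>{1..r}. w i * (1 - x i)) \<partial>?U)" for w
  have [measurable]: "Q \<in> borel_measurable (Pi\<^sub>M {1..r} (\<lambda>_. borel))"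
    unfolding Q_def by measurable
  \<comment> \<open>The completed weights sum to 1, so the two arguments of \<open>q\<close> add up
    to \<open>s\<close>, and the quotient is the weighted average itself.\<close>
  have Q_scale: "Q (\<lambda>j\<in>{1..r}. s * complete_simplex r v j) =
      (\<integral>\<^sup>+x. h (\<Sum>j\<in>{1..r}. complete_simplex r v j * x j) \<partial>?U)" if "0 < s" for s v
    unfolding Q_def
  proof (rule nn_integral_cong)
    fix x
    let ?c = "complete_simplex r v"
    have a: "(\<Sum>i\<in>{1..r}. (\<lambda>j\<in>{1..r}. s * ?c j) i * x i) = s * (\<Sum>j\<in>{1..r}. ?c j * x j)"
      by (simp add: sum_distrib_left mult.assoc)
    have b: "(\<Sum>i\<in>{1..r}. (\<lambda>j\<in>{1..r}. s * ?c j) i * (1 - x i)) = s * (1 - (\<Sum>j\<in>{1..r}. ?c j * x j))"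
    proof -
      have "(\<Sum>i\<in>{1..r}. (\<lambda>j\<in>{1..r}. s * ?c j) i * (1 - x i)) =
          s * ((\<Sum>j\<in>{1..r}. ?c j) - (\<Sum>j\<in>{1..r}. ?c j * x j))"
        by (simp add: sum_distrib_left right_diff_distrib sum_subtractf mult.assoc)
      then show ?thesis by (simp only: sum_complete_simplex[OF r])
    qed
    show "q (\<Sum>i\<in>{1..r}. (\<lambda>j\<in>{1..r}. s * ?c j) i * x i, \<Sum>i\<in>{1..r}. (\<lambda>j\<in>{1..r}. s * ?c j) i * (1 - x i)) =
        h (\<Sum>j\<in>{1..r}. ?c j * x j)"
      unfolding a b q_def using that by (simp add: right_diff_distrib)
  qed
  \<comment> \<open>Gamma laws are carried by the positive reals, so values at nonpositive
    \<open>s\<close>, including the default of division by 0, do not affect the integral.\<close>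
  have const: "(\<integral>\<^sup>+s. F s \<partial>gamma_law k) = c" if "\<And>s. 0 < s \<Longrightarrow> F s = c" for F k c
  proof -
    interpret prob_space "gamma_law k" by (rule prob_space_gamma_law)
    have "(\<integral>\<^sup>+s. F s \<partial>gamma_law k) = (\<integral>\<^sup>+s. c \<partial>gamma_law k)"
      using AE_gamma_law_pos[of k] by (intro nn_integral_cong_AE) (elim eventually_mono, simp add: that)
    then show ?thesis using emeasure_space_1 by simp
  qed
  have two: "(\<lambda>j::nat. real (Suc 1)) = (\<lambda>_. 2)" by simp
  \<comment> \<open>The Dirichlet decomposition with all \<open>a j = 1\<close> applies to the
    right-hand side; its inner integral is constant in \<open>s\<close>.\<close>
  have "?lhs = (\<integral>\<^sup>+w. Q w \<partial>Pi\<^sub>M {1..r} (\<lambda>_. gamma_law 1))"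
    by (subst nn_integral_gamma_dirichlet[OF r], measurable)
      (rule const[symmetric], simp only: two Q_scale)
  also have "\<dots> = (\<integral>\<^sup>+a. (\<integral>\<^sup>+b. q (a, b) \<partial>gamma_law (r - 1)) \<partial>gamma_law (r - 1))"
    unfolding Q_def using nn_integral_gamma_average[OF _ _ q, of "{1..r}"] r by simp
  \<comment> \<open>Here the quotient is \<open>s * z / s\<close>, so again \<open>s\<close>
    integrates out, and the Beta parameters are \<open>Suc (r - 1)\<close>.\<close>
  also have "\<dots> = ?rhs"
    using r by (subst nn_integral_gamma_beta, measurable)
      (rule const, simp add: q_def right_diff_distrib)
  finally show ?thesis .
qed

theorem corollary2p2:
  fixes M :: "'a measure" and r :: nat and X W :: "nat \<Rightarrow> 'a \<Rightarrow> real"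
  assumes "prob_space M"
    and "1 \<le> r"
    and "prob_space.indep_vars M (\<lambda>_. borel) X {1..r}"
    and "\<And>j. j \<in> {1..r} \<Longrightarrow> distr M borel (X j) = uniform_measure lborel {0<..<1}"
    and "dirichlet_distributed M r (\<lambda>_. 2) W"
    and "prob_space.indep_var M
           (Pi\<^sub>M {1..r} (\<lambda>_. borel)) (\<lambda>\<omega>. \<lambda>j\<in>{1..r}. W j \<omega>)
           (Pi\<^sub>M {1..r} (\<lambda>_. borel)) (\<lambda>\<omega>. \<lambda>j\<in>{1..r}. X j \<omega>)"
  shows "distributed M lborel (\<lambda>\<omega>. \<Sum>j\<in>{1..r}. W j \<omega> * X j \<omega>)
           (\<lambda>x. ennreal (beta_density (real r) (real r) x))"
proof -
  interpret prob_space M by fact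
  note r = \<open>1 \<le> r\<close>
  note indep_X = assms(3) and unif_X = assms(4) and W = assms(5) and indep_WX = assms(6)
  let ?I = "{1..r}" and ?J = "{1..<r}"
  let ?B = "Pi\<^sub>M ?I (\<lambda>_. borel :: real measure)"
  let ?U = "Pi\<^sub>M ?I (\<lambda>_. unif)"
  let ?W = "\<lambda>\<omega>. \<lambda>j\<in>?I. W j \<omega>" and ?X = "\<lambda>\<omega>. \<lambda>j\<in>?I. X j \<omega>" and ?V = "\<lambda>\<omega>. \<lambda>j\<in>?J. W j \<omega>"
  let ?Z = "\<lambda>\<omega>. \<Sum>j\<in>?I. W j \<omega> * X j \<omega>"
  have I: "?I = insert r ?J" using r by auto
  have meas_W [measurable]: "?W \<in> measurable M ?B" and meas_X [measurable]: "?X \<in> measurable M ?B"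
    using indep_WX unfolding indep_var_distribution_eq by auto
  have X_rv: "X j \<in> borel_measurable M" if "j \<in> ?I" for j
    using indep_X that by (auto simp: indep_vars_def)
  have W_rv: "W j \<in> borel_measurable M" if "j \<in> ?I" for j
    using W that by (auto simp: dirichlet_distributed_def)
  have Z [measurable]: "?Z \<in> borel_measurable M"
    using X_rv W_rv by (intro borel_measurable_sum borel_measurable_times) auto
  have sum_W: "AE \<omega> in M. (\<Sum>j\<in>?I. W j \<omega>) = 1"
    using W by (auto simp: dirichlet_distributed_def)
  have V: "distributed M (Pi\<^sub>M ?J (\<lambda>_. lborel)) ?V (\<lambda>w. ennreal (dirichlet_density r (\<lambda>_. 2) w))"
    using W by (simp add: dirichlet_distributed_def)
  \<comment> \<open>Independence turns the joint law of the \<open>X j\<close> into the product of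
    their uniform marginals.\<close>
  have "distr M ?B ?X = Pi\<^sub>M ?I (\<lambda>i. distr M borel (X i))"
    using indep_X r by (subst (asm) indep_vars_iff_distr_eq_PiM') (auto intro: X_rv)
  also have "\<dots> = ?U"
    by (intro PiM_cong unif_X) auto
  finally have distr_X: "distr M ?B ?X = ?U" .
  interpret U: product_sigma_finite "\<lambda>_. unif" by (rule product_sigma_finite_unif)
  interpret FU: finite_product_sigma_finite "\<lambda>_. unif" ?I by unfold_locales simp
  have joint: "distr M (?B \<Otimes>\<^sub>M ?B) (\<lambda>\<omega>. (?W \<omega>, ?X \<omega>)) = distr M ?B ?W \<Otimes>\<^sub>M ?U"
    using indep_WX unfolding indep_var_distribution_eq distr_X by simp

  \<comment> \<open>Identifies the law of the average through its integrals of all nonnegative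
    measurable functions.\<close>
  have key: "(\<integral>\<^sup>+\<omega>. h (?Z \<omega>) \<partial>M) = (\<integral>\<^sup>+z. ennreal (beta_density (real r) (real r) z) * h z \<partial>lborel)"
    if [measurable]: "h \<in> borel_measurable borel" for h
  proof -
    define H where "H w = (\<integral>\<^sup>+x. h (\<Sum>j\<in>?I. w j * x j) \<partial>?U)" for w
    have [measurable]: "H \<in> borel_measurable ?B"
      unfolding H_def by measurable
    note [measurable] = measurable_complete_simplex[OF r]
    have "(\<integral>\<^sup>+\<omega>. h (?Z \<omega>) \<partial>M) =
        (\<integral>\<^sup>+p. h (\<Sum>j\<in>?I. fst p j * snd p j) \<partial>distr M (?B \<Otimes>\<^sub>M ?B) (\<lambda>\<omega>. (?W \<omega>, ?X \<omega>)))"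
      by (subst nn_integral_distr[OF measurable_Pair[OF meas_W meas_X]]) simp_all
    \<comment> \<open>By independence of weights and variables, Fubini integrates the variables out
      first for fixed weights.\<close>
    also have "\<dots> = (\<integral>\<^sup>+w. H w \<partial>distr M ?B ?W)"
    proof -
      have "(\<lambda>p. h (\<Sum>j\<in>?I. fst p j * snd p j)) \<in> borel_measurable (distr M ?B ?W \<Otimes>\<^sub>M ?U)"
        by (subst measurable_cong_sets[OF sets_pair_measure_cong[OF sets_distr sets_PiM_unif] refl]) measurable
      from FU.nn_integral_fst[OF this] show ?thesis
        unfolding joint H_def by simp
    qed
    also have "\<dots> = (\<integral>\<^sup>+\<omega>. H (?W \<omega>) \<partial>M)"
      by (rule nn_integral_distr) measurable
    also have "\<dots> = (\<integral>\<^sup>+\<omega>. H (complete_simplex r (?V \<omega>)) \<partial>M)"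
    proof (rule nn_integral_cong_AE)
      \<comment> \<open>The density is known for the first \<open>r - 1\<close> weights only; the
        last is almost surely determined by them.\<close>
      show "AE \<omega> in M. H (?W \<omega>) = H (complete_simplex r (?V \<omega>))"
        using sum_W
      proof eventually_elim
        case (elim \<omega>)
        then have "W r \<omega> = 1 - (\<Sum>j\<in>?J. W j \<omega>)"
          unfolding I by simp
        then have "?W \<omega> = complete_simplex r (?V \<omega>)"
          using r by (auto simp: complete_simplex_def fun_eq_iff)
        then show ?case by simp
      qed
    qed
    also have "\<dots> = (\<integral>\<^sup>+v. ennreal (dirichlet_density r (\<lambda>_. 2) v) * H (complete_simplex r v) \<partial>Pi\<^sub>M ?J (\<lambda>_. lborel))"
      by (rule distributed_nn_integral[OF V, symmetric]) measurable
    also have "\<dots> = (\<integral>\<^sup>+z. ennreal (beta_density (real r) (real r) z) * h z \<partial>lborel)"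
      unfolding H_def by (rule nn_integral_dirichlet_average[OF r that])
    finally show ?thesis .
  qed
  have "distr M lborel ?Z = density lborel (\<lambda>x. ennreal (beta_density (real r) (real r) x))"
  proof (rule measure_eqI)
    fix A assume "A \<in> sets (distr M lborel ?Z)"
    then have [measurable]: "A \<in> sets borel" by simp
    have "emeasure (distr M lborel ?Z) A = (\<integral>\<^sup>+z. indicator A z \<partial>distr M lborel ?Z)"
      by simp
    also have "\<dots> = (\<integral>\<^sup>+\<omega>. indicator A (?Z \<omega>) \<partial>M)"
      by (rule nn_integral_distr) measurable
    \<comment> \<open>The integral identity is applied to the indicator of \<open>A\<close>.\<close>
    also have "\<dots> = emeasure (density lborel (\<lambda>x. ennreal (beta_density (real r) (real r) x))) A"
      by (subst key) (auto simp: emeasure_density)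
    finally show "emeasure (distr M lborel ?Z) A =
        emeasure (density lborel (\<lambda>x. ennreal (beta_density (real r) (real r) x))) A" .
  qed simp
  then show ?thesis
    unfolding distributed_def using Z by (simp del: One_nat_def)
qed

end
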